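(* For all $n\ge1$: (1) $P_{0,0,2n}=(n!)^2$; (2) $P_{1,0,2n}=n!(n+1)!-(n!)^2=n(n!)^2$; (3) $P_{0,0,2n+1}=n!(n+1)!$; (4) $P_{1,0,2n+1}=((n+1)!)^2-n!(n+1)!=n\,(n!(n+1)!)$.
   Context: $\mathcal{S}_m$ denotes the set of permutations $\sigma=\sigma_1\cdots\sigma_m$ of $\{1,\dots,m\}$. $\overrightarrow{des}_E(\sigma)$ is the number of indices $i\in\{1,\dots,m-1\}$ with $\sigma_i>\sigma_{i+1}$ and $\sigma_{i+1}$ even. For $j\in\{0,1\}$, $P_{j,k,m}$ is the number of $\sigma\in\mathcal{S}_m$ with $\overrightarrow{des}_E(\sigma)=k$ such that $\sigma_1$ is even if $j=1$ and $\sigma_1$ is odd if $j=0$ (i.e. the coefficient of $z^jx^k$ in $\sum_{\sigma\in\mathcal{S}_m}x^{\overrightarrow{des}_E(\sigma)}z^{\chi(\sigma_1\text{ even})}$). *)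

theory Defs
  imports Complex_Main "HOL-Combinatorics.Combinatorics"
begin

definition des_E :: "nat \<Rightarrow> (nat \<Rightarrow> nat) \<Rightarrow> nat" where
  "des_E m \<sigma> = card {i \<in> {1..m - 1}. \<sigma> i > \<sigma> (i + 1) \<and> even (\<sigma> (i + 1))}"

definition P_num :: "nat \<Rightarrow> nat \<Rightarrow> nat \<Rightarrow> nat" where
  "P_num j k m = card {\<sigma>. \<sigma> permutes {1..m} \<and> des_E m \<sigma> = k \<and> of_bool (even (\<sigma> 1)) = j}"

end

theory Submission
  imports Defs
begin

text \<open>Delete the largest letter \<open>m + 1\<close> from a word on \<open>{1..m + 1}\<close> without even descent bottoms: it
  is never a descent bottom itself, and what follows it must be odd, so the remaining word again has
  no even descent bottom. Conversely, \<open>m + 1\<close> may be inserted exactly at the end or in front of an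
  odd letter, which gives \<open>1 + \<lceil>m/2\<rceil>\<close> extensions. If the first letter is to stay odd, the front slot
  is forbidden when \<open>m + 1\<close> is even, and \<open>1 + \<lfloor>m/2\<rfloor>\<close> extensions remain in both parities.
  The factorial formulas follow by multiplying these factors.\<close>

section \<open>Words without even descent bottoms and their insertion slots\<close>

abbreviation no_even_descent :: "nat list \<Rightarrow> bool" where
  "no_even_descent \<equiv> successively (\<lambda>a b. a \<le> b \<or> odd b)"

definition nd_words :: "nat \<Rightarrow> nat list set" where
  "nd_words m = {xs \<in> permutations_of_set {1..m}. no_even_descent xs}"

text \<open>Position \<open>k\<close> stands for the gap in front of the letter
  \<open>xs ! k\<close>, and \<open>length xs\<close> for the gap at the end.\<close>

definition slots :: "nat list \<Rightarrow> nat set" where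
  "slots xs = {k. k \<le> length xs \<and> (k < length xs \<longrightarrow> odd (xs ! k))}"

definition insert_at :: "'a \<Rightarrow> nat \<Rightarrow> 'a list \<Rightarrow> 'a list" where
  "insert_at x k xs = take k xs @ x # drop k xs"

lemma nd_words_iff:
  "xs \<in> nd_words m \<longleftrightarrow> set xs = {1..m} \<and> distinct xs \<and> no_even_descent xs"
  by (auto simp: nd_words_def permutations_of_set_def)

lemma finite_nd_words [simp]: "finite (nd_words m)"
  by (simp add: nd_words_def)

lemma finite_slots [simp]: "finite (slots xs)"
  by (simp add: slots_def)

lemma length_nd_words: "xs \<in> nd_words m \<Longrightarrow> length xs = m"
  by (metis nd_words_iff distinct_card card_atLeastAtMost diff_Suc_1)

lemma card_odd_atLeastAtMost: "card {x \<in> {1..m}. odd x} = Suc m div 2"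
proof (induction m)
  case (Suc m)
  have "{x \<in> {1..Suc m}. odd x} =
      (if even m then insert (Suc m) {x \<in> {1..m}. odd x} else {x \<in> {1..m}. odd x})"
    by (auto simp: le_Suc_eq)
  then show ?case
    using Suc by (auto elim!: evenE oddE)
qed simp

text \<open>One slot is the end; the others are the positions of odd letters. Since the letters are
  distinct, these positions correspond to the odd numbers up to \<open>m\<close>.\<close>

lemma card_slots:
  assumes "xs \<in> nd_words m"
  shows "card (slots xs) = Suc (Suc m div 2)"
proof -
  let ?I = "{k. k < length xs \<and> odd (xs ! k)}"
  have "slots xs = insert (length xs) ?I"
    by (auto simp: slots_def)
  then have "card (slots xs) = Suc (card ?I)"
    by simp
  also have "card ?I = card ((!) xs ` ?I)"
    using assms by (intro card_image [symmetric] inj_on_nth) (auto simp: nd_words_iff)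
  also have "(!) xs ` ?I = {x \<in> set xs. odd x}"
    by (auto simp: in_set_conv_nth)
  finally show ?thesis
    using assms card_odd_atLeastAtMost [of m] by (simp add: nd_words_iff)
qed

section \<open>Inserting and deleting the largest letter\<close>

lemma no_even_descent_insert_max:
  assumes "\<forall>x \<in> set us \<union> set vs. x < M"
  shows "no_even_descent (us @ M # vs) \<longleftrightarrow>
    no_even_descent (us @ vs) \<and> (vs \<noteq> [] \<longrightarrow> odd (hd vs))"
proof -
  \<comment> \<open>Only adjacent pairs at the seam change. The pair ending in \<open>M\<close> is
    an ascent; the pair starting with \<open>M\<close> is a descent and forces \<open>hd vs\<close>
    to be odd. Then \<open>hd vs\<close> is also harmless directly after
    \<open>last us\<close>.\<close>
  have "us \<noteq> [] \<Longrightarrow> last us < M" "vs \<noteq> [] \<Longrightarrow> hd vs < M"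
    using assms by auto
  then show ?thesis
    by (cases vs) (auto simp: successively_append_iff successively_Cons)
qed

text \<open>The inverse deletes \<open>Suc m\<close> and recovers the slot as the number of letters
  in front of it.\<close>

lemma bij_betw_insert_at_nd_words:
  "bij_betw (\<lambda>(xs, k). insert_at (Suc m) k xs) (SIGMA xs:nd_words m. slots xs) (nd_words (Suc m))"
proof (rule bij_betw_byWitness
    [where f' = "\<lambda>ys. (remove1 (Suc m) ys, length (takeWhile (\<lambda>y. y \<noteq> Suc m) ys))"])
  have remove: "remove1 M (us @ M # vs) = us @ vs"
      "takeWhile (\<lambda>y. y \<noteq> M) (us @ M # vs) = us"
    if "M \<notin> set us" for M :: nat and us vs
    using that by (induction us) auto
  \<comment> \<open>Splitting a word around its largest letter serves twice: to show that
    reinsertion restores the word, and that deletion yields a valid word with a valid slot.\<close>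
  have split: "\<exists>us vs. ys = us @ Suc m # vs \<and> Suc m \<notin> set us \<and> us @ vs \<in> nd_words m
      \<and> length us \<in> slots (us @ vs)" if "ys \<in> nd_words (Suc m)" for ys
  proof -
    have ys: "set ys = {1..Suc m}" "distinct ys" "no_even_descent ys"
      using that by (auto simp: nd_words_iff)
    then have "Suc m \<in> set ys"
      by simp
    then obtain us vs where eq: "ys = us @ Suc m # vs"
      by (meson split_list)
    have notin: "Suc m \<notin> set us" "Suc m \<notin> set vs"
      using ys(2) eq by auto
    have "set (us @ vs) = set ys - {Suc m}"
      using eq notin by auto
    also have "\<dots> = {1..m}"
      unfolding ys(1) by auto
    finally have set: "set (us @ vs) = {1..m}" .
    then have lt: "\<forall>x \<in> set us \<union> set vs. x < Suc m"
      by auto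
    have "no_even_descent (us @ vs) \<and> (vs \<noteq> [] \<longrightarrow> odd (hd vs))"
      using ys(3) eq no_even_descent_insert_max [OF lt] by simp
    moreover have "distinct (us @ vs)"
      using ys(2) eq by auto
    ultimately have "us @ vs \<in> nd_words m" "length us \<in> slots (us @ vs)"
      using set by (auto simp: nd_words_iff slots_def nth_append hd_conv_nth)
    then show ?thesis
      using eq notin by (intro exI [of _ us] exI [of _ vs]) simp
  qed
  show "\<forall>p \<in> SIGMA xs:nd_words m. slots xs.
      (\<lambda>ys. (remove1 (Suc m) ys, length (takeWhile (\<lambda>y. y \<noteq> Suc m) ys)))
        ((\<lambda>(xs, k). insert_at (Suc m) k xs) p) = p"
  proof
    fix p
    assume "p \<in> (SIGMA xs:nd_words m. slots xs)"
    then obtain xs k where p: "p = (xs, k)" and xs: "xs \<in> nd_words m" and k: "k \<in> slots xs"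
      by blast
    \<comment> \<open>Hence \<open>takeWhile\<close> stops exactly at the inserted letter, and
      \<open>k \<le> length xs\<close> gives the prefix length \<open>k\<close>.\<close>
    have "Suc m \<notin> set (take k xs)"
      using xs by (auto simp: nd_words_iff dest: in_set_takeD)
    then show "(\<lambda>ys. (remove1 (Suc m) ys, length (takeWhile (\<lambda>y. y \<noteq> Suc m) ys)))
        ((\<lambda>(xs, k). insert_at (Suc m) k xs) p) = p"
      using k p by (simp add: insert_at_def remove slots_def)
  qed
  show "\<forall>ys \<in> nd_words (Suc m). (\<lambda>(xs, k). insert_at (Suc m) k xs)
      (remove1 (Suc m) ys, length (takeWhile (\<lambda>y. y \<noteq> Suc m) ys)) = ys"
  proof
    fix ys
    assume "ys \<in> nd_words (Suc m)"
    from split [OF this] obtain us vs where "ys = us @ Suc m # vs" "Suc m \<notin> set us"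
      by blast
    then show "(\<lambda>(xs, k). insert_at (Suc m) k xs)
        (remove1 (Suc m) ys, length (takeWhile (\<lambda>y. y \<noteq> Suc m) ys)) = ys"
      by (simp add: remove insert_at_def)
  qed
  show "(\<lambda>(xs, k). insert_at (Suc m) k xs) ` (SIGMA xs:nd_words m. slots xs) \<subseteq> nd_words (Suc m)"
  proof clarify
    fix xs k
    assume xs: "xs \<in> nd_words m" and k: "k \<in> slots xs"
    have set: "set (take k xs) \<union> set (drop k xs) = {1..m}"
      using xs by (metis nd_words_iff append_take_drop_id set_append)
    then have lt: "\<forall>x \<in> set (take k xs) \<union> set (drop k xs). x < Suc m"
      by auto
    have "no_even_descent (insert_at (Suc m) k xs)"
      using xs k no_even_descent_insert_max [OF lt]
      by (auto simp: insert_at_def nd_words_iff slots_def hd_drop_conv_nth)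
    moreover have "distinct (insert_at (Suc m) k xs)"
      using xs lt set_take_disj_set_drop_if_distinct [of xs k k]
      by (auto simp: insert_at_def nd_words_iff)
    moreover have "set (insert_at (Suc m) k xs) = {1..Suc m}"
      using set by (auto simp: insert_at_def)
    ultimately show "insert_at (Suc m) k xs \<in> nd_words (Suc m)"
      by (simp add: nd_words_iff)
  qed
  show "(\<lambda>ys. (remove1 (Suc m) ys, length (takeWhile (\<lambda>y. y \<noteq> Suc m) ys))) ` nd_words (Suc m)
      \<subseteq> (SIGMA xs:nd_words m. slots xs)"
  proof (rule image_subsetI)
    fix ys
    assume "ys \<in> nd_words (Suc m)"
    from split [OF this] obtain us vs where "ys = us @ Suc m # vs" "Suc m \<notin> set us"
        "us @ vs \<in> nd_words m" "length us \<in> slots (us @ vs)"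
      by blast
    then show "(remove1 (Suc m) ys, length (takeWhile (\<lambda>y. y \<noteq> Suc m) ys))
        \<in> (SIGMA xs:nd_words m. slots xs)"
      by (simp add: remove)
  qed
qed

section \<open>Recurrences in the length of the word\<close>

lemma card_nd_words_Suc: "card (nd_words (Suc m)) = card (nd_words m) * Suc (Suc m div 2)"
proof -
  have "card (nd_words (Suc m)) = card (SIGMA xs:nd_words m. slots xs)"
    by (rule bij_betw_same_card [OF bij_betw_insert_at_nd_words, symmetric])
  also have "\<dots> = card (nd_words m) * Suc (Suc m div 2)"
    by (simp add: card_slots)
  finally show ?thesis .
qed

text \<open>In a nonempty word, only insertion at slot 0 changes the first letter, replacing it by
  \<open>Suc m\<close>. So a word with odd first letter loses one slot when \<open>m\<close> is odd
  and none when \<open>m\<close> is even.\<close>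

lemma card_nd_words_odd_hd_Suc:
  assumes "m \<ge> 1"
  shows "card {xs \<in> nd_words (Suc m). odd (hd xs)} =
    card {xs \<in> nd_words m. odd (hd xs)} * Suc (m div 2)"
proof -
  let ?ins = "\<lambda>(xs, k). insert_at (Suc m) k xs"
  let ?S = "SIGMA xs:nd_words m. slots xs"
  let ?T = "SIGMA xs:{xs \<in> nd_words m. odd (hd xs)}. {k \<in> slots xs. k = 0 \<longrightarrow> even m}"
  have hd_iff: "odd (hd (insert_at (Suc m) k xs)) \<longleftrightarrow> odd (hd xs) \<and> (k = 0 \<longrightarrow> even m)"
    if "xs \<in> nd_words m" "k \<in> slots xs" for xs k
  proof (cases "k = 0")
    \<comment> \<open>Slot 0 of a nonempty word is available only if the first letter is odd, so
      front insertion never turns an even first letter into an odd one.\<close>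
    case True
    moreover have "xs \<noteq> []"
      using length_nd_words [OF that(1)] assms by auto
    ultimately show ?thesis
      using that(2) by (auto simp: insert_at_def slots_def hd_conv_nth)
  next
    case False
    moreover have "xs \<noteq> []"
      using length_nd_words [OF that(1)] assms by auto
    ultimately show ?thesis
      by (simp add: insert_at_def hd_append)
  qed
  \<comment> \<open>The bijection is restricted to the pairs whose insertion result starts with an
    odd letter; \<open>hd_iff\<close> identifies these pairs as \<open>?T\<close>.\<close>
  have "bij_betw ?ins ?T (?ins ` ?T)"
    by (rule bij_betw_subset [OF bij_betw_insert_at_nd_words]) auto
  moreover have "?ins ` ?T = {xs \<in> ?ins ` ?S. odd (hd xs)}"
    using hd_iff by (auto simp: image_iff)
  ultimately have "card {xs \<in> nd_words (Suc m). odd (hd xs)} = card ?T"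
    using bij_betw_imp_surj_on [OF bij_betw_insert_at_nd_words [of m]]
    by (simp add: bij_betw_same_card)
  also have "\<dots> = (\<Sum>xs \<in> {xs \<in> nd_words m. odd (hd xs)}. Suc (m div 2))"
  proof (subst card_SigmaI, simp, simp, rule sum.cong [OF refl])
    fix xs
    assume "xs \<in> {xs \<in> nd_words m. odd (hd xs)}"
    then have xs: "xs \<in> nd_words m" "odd (hd xs)"
      by auto
    have "xs \<noteq> []"
      using length_nd_words [OF xs(1)] assms by auto
    then have "0 \<in> slots xs"
      using xs(2) by (simp add: slots_def hd_conv_nth)
    moreover have "{k \<in> slots xs. k = 0 \<longrightarrow> even m} = (if even m then slots xs else slots xs - {0})"
      by auto
    \<comment> \<open>For even \<open>m\<close> all \<open>m div 2 + 1\<close> slots remain; for odd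
      \<open>m\<close> there are \<open>m div 2 + 2\<close> slots, of which slot 0 is
      removed.\<close>
    ultimately show "card {k \<in> slots xs. k = 0 \<longrightarrow> even m} = Suc (m div 2)"
      using card_slots [OF xs(1)] by (auto elim!: evenE oddE)
  qed
  finally show ?thesis
    by simp
qed

section \<open>Closed forms by induction over two lengths at a time\<close>

lemma card_nd_words:
  "card (nd_words (2 * n)) = fact n * fact (n + 1)"
  "card (nd_words (2 * n + 1)) = (fact (n + 1))\<^sup>2"
proof -
  have odd: "card (nd_words (2 * n + 1)) = card (nd_words (2 * n)) * (n + 1)" for n
    using card_nd_words_Suc [of "2 * n"] by simp
  have even: "card (nd_words (2 * n)) = fact n * fact (n + 1)" for n
  proof (induction n)
    case 0
    have "nd_words 0 = {[]}"
      by (auto simp: nd_words_iff)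
    then show ?case
      by simp
  next
    \<comment> \<open>The two growth factors are \<open>n + 1\<close>, from length
      \<open>2 * n\<close> to \<open>2 * n + 1\<close>, and \<open>n + 2\<close>, to the next even
      length.\<close>
    case (Suc n)
    then show ?case
      using card_nd_words_Suc [of "2 * n + 1"] odd [of n] by (simp add: algebra_simps)
  qed
  show "card (nd_words (2 * n)) = fact n * fact (n + 1)"
    by (rule even)
  show "card (nd_words (2 * n + 1)) = (fact (n + 1))\<^sup>2"
    unfolding odd even by (simp add: power2_eq_square algebra_simps)
qed

text \<open>Starting at even length \<open>2 * n\<close>, both of the next two growth factors are
  \<open>n + 1\<close>, which produces the square.\<close>

lemma card_nd_words_odd_hd:
  assumes "n \<ge> 1"
  shows "card {xs \<in> nd_words (2 * n). odd (hd xs)} = (fact n)\<^sup>2"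
    and "card {xs \<in> nd_words (2 * n + 1). odd (hd xs)} = fact n * fact (n + 1)"
proof -
  \<comment> \<open>The recurrence requires a nonempty word, so it starts from the single word of
    length 1.\<close>
  have one: "card {xs \<in> nd_words 1. odd (hd xs)} = 1"
  proof -
    have "{xs \<in> nd_words 1. odd (hd xs)} = {[1]}"
      by (auto simp: nd_words_def)
    then show ?thesis
      by simp
  qed
  have odd: "card {xs \<in> nd_words (2 * n + 1). odd (hd xs)} =
      card {xs \<in> nd_words (2 * n). odd (hd xs)} * (n + 1)" if "n \<ge> 1" for n
    using card_nd_words_odd_hd_Suc [of "2 * n"] that by simp
  have even: "card {xs \<in> nd_words (2 * n). odd (hd xs)} = (fact n)\<^sup>2" if "n \<ge> 1" for n
    using that
  proof (induction n rule: dec_induct)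
    case base
    show ?case
      using card_nd_words_odd_hd_Suc [of 1] one by (simp add: numeral_2_eq_2)
  next
    case (step n)
    then show ?case
      using card_nd_words_odd_hd_Suc [of "2 * n + 1"] odd [of n]
      by (simp add: algebra_simps power2_eq_square)
  qed
  show "card {xs \<in> nd_words (2 * n). odd (hd xs)} = (fact n)\<^sup>2"
    by (rule even [OF assms])
  show "card {xs \<in> nd_words (2 * n + 1). odd (hd xs)} = fact n * fact (n + 1)"
    unfolding odd [OF assms] even [OF assms] by (simp add: power2_eq_square algebra_simps)
qed

section \<open>From permutations as functions to words\<close>

lemma bij_betw_map_permutations_of_set:
  "bij_betw (\<lambda>\<sigma>. map \<sigma> [1..<Suc m]) {\<sigma>. \<sigma> permutes {1..m}} (permutations_of_set {1..m})"
proof -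
  let ?f = "\<lambda>\<sigma>. map \<sigma> [1..<Suc m]"
  have inj: "inj_on ?f {\<sigma>. \<sigma> permutes {1..m}}"
  proof (rule inj_onI)
    fix \<sigma> \<tau>
    assume perm: "\<sigma> \<in> {\<sigma>. \<sigma> permutes {1..m}}" "\<tau> \<in> {\<sigma>. \<sigma> permutes {1..m}}"
      and "?f \<sigma> = ?f \<tau>"
    then have "\<forall>i \<in> {1..m}. \<sigma> i = \<tau> i"
      by (simp only: map_eq_conv set_upt atLeastLessThanSuc_atLeastAtMost)
    \<comment> \<open>Outside \<open>{1..m}\<close> both permutations are the identity.\<close>
    then show "\<sigma> = \<tau>"
      using perm by (metis ext mem_Collect_eq permutes_not_in)
  qed
  have "?f ` {\<sigma>. \<sigma> permutes {1..m}} \<subseteq> permutations_of_set {1..m}"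
  proof clarify
    fix \<sigma> :: "nat \<Rightarrow> nat"
    assume \<sigma>: "\<sigma> permutes {1..m}"
    have "set (?f \<sigma>) = \<sigma> ` {1..m}"
      by (simp only: set_map set_upt atLeastLessThanSuc_atLeastAtMost)
    moreover have "distinct (?f \<sigma>)"
      using permutes_inj_on [OF \<sigma>] by (simp add: distinct_map del: upt_Suc)
    ultimately show "?f \<sigma> \<in> permutations_of_set {1..m}"
      using permutes_image [OF \<sigma>] by (simp add: permutations_of_set_def)
  qed
  \<comment> \<open>Surjectivity by counting: the injective image and the target both have
    \<open>fact m\<close> elements.\<close>
  moreover have "card (?f ` {\<sigma>. \<sigma> permutes {1..m}}) = card (permutations_of_set {1..m})"
    using card_permutations [of "{1..m}" m] by (simp only: card_image [OF inj]) simp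
  ultimately have "?f ` {\<sigma>. \<sigma> permutes {1..m}} = permutations_of_set {1..m}"
    by (intro card_subset_eq) auto
  then show ?thesis
    using inj by (simp add: bij_betw_def)
qed

lemma des_E_eq_0_iff: "des_E m \<sigma> = 0 \<longleftrightarrow> no_even_descent (map \<sigma> [1..<Suc m])"
proof -
  have "des_E m \<sigma> = 0 \<longleftrightarrow> (\<forall>i \<in> {1..m - 1}. \<sigma> i \<le> \<sigma> (i + 1) \<or> odd (\<sigma> (i + 1)))"
    by (auto simp: des_E_def not_less)
  \<comment> \<open>Words are indexed from 0 and permutations from 1; the shift by
    \<open>Suc\<close> aligns the indices of adjacent pairs.\<close>
  also have "{1..m - 1} = Suc ` {..<m - 1}"
    by (simp add: image_Suc_lessThan)
  also have "(\<forall>i \<in> Suc ` {..<m - 1}. \<sigma> i \<le> \<sigma> (i + 1) \<or> odd (\<sigma> (i + 1))) \<longleftrightarrow>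
      no_even_descent (map \<sigma> [1..<Suc m])"
    by (auto simp: successively_conv_nth less_diff_conv simp del: upt_Suc)
  finally show ?thesis .
qed

lemma P_num_0_eq_card:
  assumes "m \<ge> 1"
  shows "P_num j 0 m = card {xs \<in> nd_words m. of_bool (even (hd xs)) = j}"
proof -
  let ?f = "\<lambda>\<sigma>::nat \<Rightarrow> nat. map \<sigma> [1..<Suc m]"
  let ?A = "{\<sigma>. \<sigma> permutes {1..m}}"
  let ?Q = "\<lambda>xs. no_even_descent xs \<and> of_bool (even (hd xs)) = j"
  \<comment> \<open>Here \<open>m \<ge> 1\<close> makes the word nonempty, as \<open>hd []\<close>
    is unspecified.\<close>
  have hd: "hd (?f \<sigma>) = \<sigma> 1" for \<sigma>
    using assms by (simp add: hd_map del: upt_Suc)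
  have "P_num j 0 m = card {\<sigma> \<in> ?A. ?Q (?f \<sigma>)}"
    by (simp only: P_num_def des_E_eq_0_iff hd mem_Collect_eq)
  also have "\<dots> = card (?f ` {\<sigma> \<in> ?A. ?Q (?f \<sigma>)})"
    using bij_betw_imp_inj_on [OF bij_betw_map_permutations_of_set]
    by (rule card_image [symmetric, OF inj_on_subset]) blast
  also have "?f ` {\<sigma> \<in> ?A. ?Q (?f \<sigma>)} = {xs \<in> ?f ` ?A. ?Q xs}"
    by blast
  also have "\<dots> = {xs \<in> nd_words m. of_bool (even (hd xs)) = j}"
    unfolding bij_betw_imp_surj_on [OF bij_betw_map_permutations_of_set] nd_words_def by blast
  finally show ?thesis .
qed

section \<open>Separation by the parity of the first letter\<close>

lemma P_num_0_0: "m \<ge> 1 \<Longrightarrow> P_num 0 0 m = card {xs \<in> nd_words m. odd (hd xs)}"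
  using P_num_0_eq_card [of m 0] by (simp only: of_bool_eq_0_iff)

lemma P_num_1_0: "m \<ge> 1 \<Longrightarrow> P_num 1 0 m = card {xs \<in> nd_words m. even (hd xs)}"
  using P_num_0_eq_card [of m 1] by (simp only: of_bool_eq_1_iff)

text \<open>This gives the count for an even first letter as a complement, without a recurrence of
  its own.\<close>

lemma P_num_sum:
  assumes "m \<ge> 1"
  shows "P_num 0 0 m + P_num 1 0 m = card (nd_words m)"
proof -
  have "card (nd_words m) =
      card ({xs \<in> nd_words m. odd (hd xs)} \<union> {xs \<in> nd_words m. even (hd xs)})"
    by (rule arg_cong [of _ _ card]) blast
  also have "\<dots> = card {xs \<in> nd_words m. odd (hd xs)} + card {xs \<in> nd_words m. even (hd xs)}"
    by (rule card_Un_disjoint) auto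
  finally show ?thesis
    using P_num_0_0 [OF assms] P_num_1_0 [OF assms] by simp
qed

theorem theorem4p3:
  fixes n :: nat
  assumes "n \<ge> 1"
  shows "P_num 0 0 (2 * n) = (fact n)\<^sup>2
    \<and> (int (P_num 1 0 (2 * n)) = fact n * fact (n + 1) - (fact n)\<^sup>2
        \<and> fact n * fact (n + 1) - (fact n)\<^sup>2 = int n * (fact n)\<^sup>2)
    \<and> P_num 0 0 (2 * n + 1) = fact n * fact (n + 1)
    \<and> (int (P_num 1 0 (2 * n + 1)) = (fact (n + 1))\<^sup>2 - fact n * fact (n + 1)
        \<and> (fact (n + 1))\<^sup>2 - fact n * fact (n + 1) = int n * (fact n * fact (n + 1)))"
proof -
  have even: "P_num 0 0 (2 * n) = (fact n)\<^sup>2"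
    using assms card_nd_words_odd_hd(1) [OF assms] by (simp add: P_num_0_0)
  have odd: "P_num 0 0 (2 * n + 1) = fact n * fact (n + 1)"
    using card_nd_words_odd_hd(2) [OF assms] P_num_0_0 [of "2 * n + 1"] by simp
  \<comment> \<open>Passing to the integers makes the coming subtraction a true one rather than the
    truncated one on naturals.\<close>
  have "int (P_num 0 0 (2 * n) + P_num 1 0 (2 * n)) = int (fact n * fact (n + 1))"
    using assms P_num_sum [of "2 * n"] card_nd_words(1) [of n] by simp
  then have even': "int (P_num 1 0 (2 * n)) = fact n * fact (n + 1) - (fact n)\<^sup>2"
    unfolding even by (simp only: of_nat_add of_nat_mult of_nat_power of_nat_fact)
  have "int (P_num 0 0 (2 * n + 1) + P_num 1 0 (2 * n + 1)) = int ((fact (n + 1))\<^sup>2)"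
    using P_num_sum [of "2 * n + 1"] card_nd_words(2) [of n] by simp
  then have odd': "int (P_num 1 0 (2 * n + 1)) = (fact (n + 1))\<^sup>2 - fact n * fact (n + 1)"
    unfolding odd by (simp only: of_nat_add of_nat_mult of_nat_power of_nat_fact)
  \<comment> \<open>The remaining factored forms come from
    \<open>fact (n + 1) = (n + 1) * fact n\<close>.\<close>
  show ?thesis
    using even odd even' odd' by (simp add: power2_eq_square algebra_simps)
qed

end
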